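(* Let $P\ge 1$, let $\{(y_p,z_p)\in\mathbb{R}^2 : p=0,1,\ldots,P\}$ be a data set with $y_0<y_1<\cdots<y_P$, and put $A=[y_0,y_P]$ and $A_p=[y_{p-1},y_p]$. For $p=1,\ldots,P$ let $L_p:A\to A_p$ be contraction homeomorphisms with $L_p(y_0)=y_{p-1}$ and $L_p(y_P)=y_p$. For $p=1,\ldots,P$ let $F_p:A\times\mathbb{R}\to\mathbb{R}$ be given by $F_p(y,z)=\alpha_p z+q_p(y)$, where $\alpha_p\in\mathbb{R}$ and $q_p:A\to\mathbb{R}$ is continuous, and assume that the $F_p$ are continuous in the first variable, are Suzuki-type generalized $\varphi$-contractions in the second variable, and satisfy $F_p(y_0,z_0)=z_{p-1}$ and $F_p(y_P,z_P)=z_p$. Let $\mathcal{C}(A)$ be the space of continuous functions $h:A\to\mathbb{R}$ with norm $\|h\|=|h|_\infty=\max_{y\in A}|h(y)|$, and let $\mathcal{C}_0(A)=\{h\in\mathcal{C}(A): h(y_0)=z_0,\ h(y_P)=z_P\}$. Then the operator $\mathbb{T}:\mathcal{C}_0(A)\to\mathcal{C}_0(A)$ defined by $$(\mathbb{T}h)(y)=F_p\big(L_p^{-1}(y),\,h(L_p^{-1}(y))\big),\qquad y\in A_p,\ p=1,\ldots,P,$$ has a fixed point in $\mathcal{C}(A)$, i.e. there exists $g\in\mathcal{C}_0(A)\subset\mathcal{C}(A)$ with $\mathbb{T}g=g$.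
   Context: The maps $F_p$ are Suzuki-type generalized $\varphi$-contractions (STGPC) in the second variable if there is a function $\varphi:[0,\infty)\to[0,\infty)$ with $\varphi(t)<t$ for all $t>0$ and $\limsup_{s\to t^+}\varphi(s)<t$ for all $t>0$, such that for all $p=1,\ldots,P$, all $y\in A$ and all $z,t\in\mathbb{R}$, $$\tfrac12|z-F_p(y,z)|\le|z-t|\ \Longrightarrow\ |F_p(y,z)-F_p(y,t)|\le\varphi\big(\max\{|z-t|,|z-F_p(y,z)|,|t-F_p(y,t)|\}\big).$$ *)

theory Defs
  imports "HOL-Analysis.Analysis"
begin

(* The one-sided upper limit is taken in ereal because real is not a complete lattice. *)
definition comparison_function :: "(real \<Rightarrow> real) \<Rightarrow> bool" where
  "comparison_function \<phi> \<longleftrightarrow>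
     (\<forall>t\<ge>0. \<phi> t \<ge> 0) \<and>
     (\<forall>t>0. \<phi> t < t) \<and>
     (\<forall>t>0. Limsup (at_right t) (\<lambda>s. ereal (\<phi> s)) < ereal t)"

(* One phi serves all indices p and all points y of A. *)
definition STGPC :: "nat \<Rightarrow> real set \<Rightarrow> (nat \<Rightarrow> real \<Rightarrow> real \<Rightarrow> real) \<Rightarrow> bool" where
  "STGPC P A F \<longleftrightarrow>
     (\<exists>\<phi>. comparison_function \<phi> \<and>
       (\<forall>p\<in>{1..P}. \<forall>y\<in>A. \<forall>z t.
          1/2 * \<bar>z - F p y z\<bar> \<le> \<bar>z - t\<bar> \<longrightarrow>
          \<bar>F p y z - F p y t\<bar>
            \<le> \<phi> (Max {\<bar>z - t\<bar>, \<bar>z - F p y z\<bar>, \<bar>t - F p y t\<bar>})))"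

(* Continuous real functions on A with the sup metric. The elements are extensional
   (undefined off A), so equality of elements is equality as functions on A. *)
abbreviation C_metric :: "real set \<Rightarrow> (real \<Rightarrow> real) metric" where
  "C_metric A \<equiv> cfunspace (top_of_set A) euclidean_metric"

abbreviation C_space :: "real set \<Rightarrow> (real \<Rightarrow> real) set" where
  "C_space A \<equiv> mspace (C_metric A)"

definition C0_space :: "nat \<Rightarrow> (nat \<Rightarrow> real) \<Rightarrow> (nat \<Rightarrow> real) \<Rightarrow> (real \<Rightarrow> real) set" where
  "C0_space P ys zs = {h \<in> C_space {ys 0..ys P}. h (ys 0) = zs 0 \<and> h (ys P) = zs P}"

(* At a common endpoint of two adjacent subintervals the branch of smaller index is taken;
   that the branches agree there is a consequence of the matching conditions on F. *)
definition RB_operator ::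
  "nat \<Rightarrow> (nat \<Rightarrow> real) \<Rightarrow> (nat \<Rightarrow> real \<Rightarrow> real) \<Rightarrow> (nat \<Rightarrow> real \<Rightarrow> real \<Rightarrow> real) \<Rightarrow>
     (real \<Rightarrow> real) \<Rightarrow> real \<Rightarrow> real" where
  "RB_operator P ys L F h =
     (\<lambda>y\<in>{ys 0..ys P}.
        let p = (LEAST p. p \<in> {1..P} \<and> y \<in> {ys (p - 1)..ys p});
            x = inv_into {ys 0..ys P} (L p) y
        in F p x (h x))"

end

theory Submission
  imports Defs
begin

text \<open>
  The Suzuki condition always admits the choice \<open>t = F\<^sub>p(y,z)\<close>, since
  \<open>\<bar>z - F\<^sub>p(y,z)\<bar> / 2 \<le> \<bar>z - F\<^sub>p(y,z)\<bar>\<close>. For affine \<open>F\<^sub>p(y,\<cdot>)\<close> with slope \<open>\<alpha>\<^sub>p\<close> and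
  \<open>d = \<bar>z - F\<^sub>p(y,z)\<bar> > 0\<close> it reads \<open>\<bar>\<alpha>\<^sub>p\<bar> d \<le> \<phi> (max d (\<bar>\<alpha>\<^sub>p\<bar> d)) < max d (\<bar>\<alpha>\<^sub>p\<bar> d)\<close>, which forces
  \<open>\<bar>\<alpha>\<^sub>p\<bar> < 1\<close>; if no such \<open>z\<close> exists, \<open>F\<^sub>p(y,\<cdot>)\<close> is the identity, which \<open>\<phi> 1 < 1\<close> excludes. Hence the operator is a Banach contraction with factor \<open>max\<^sub>p \<bar>\<alpha>\<^sub>p\<bar>\<close> on the
  complete space \<open>C\<^sub>0(A)\<close>.
\<close>

lemma Suzuki_affine_slope_less_one:
  fixes f :: "real \<Rightarrow> real" and a b :: real
  assumes less: "\<And>t. t > 0 \<Longrightarrow> \<phi> t < t"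
    and f: "\<And>z. f z = a * z + b"
    and Suzuki: "\<And>z t. 1/2 * \<bar>z - f z\<bar> \<le> \<bar>z - t\<bar> \<Longrightarrow>
          \<bar>f z - f t\<bar> \<le> \<phi> (Max {\<bar>z - t\<bar>, \<bar>z - f z\<bar>, \<bar>t - f t\<bar>})"
  shows "\<bar>a\<bar> < 1"
proof (cases "\<forall>z. f z = z")
  case True
  then show ?thesis
    using Suzuki [of 0 1] less [of 1] by simp
next
  case False
  then obtain z where "f z \<noteq> z"
    by blast
  define d where "d = \<bar>z - f z\<bar>"
  have "d > 0"
    using \<open>f z \<noteq> z\<close> by (simp add: d_def)
  have "f z - f (f z) = a * (z - f z)"
    by (simp add: f algebra_simps)
  then have image: "\<bar>f z - f (f z)\<bar> = \<bar>a\<bar> * d"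
    by (simp add: abs_mult d_def)
  have "\<bar>a\<bar> * d \<le> \<phi> (max d (\<bar>a\<bar> * d))"
    using Suzuki [of z "f z"] \<open>d > 0\<close> by (simp add: image flip: d_def)
  also have "\<dots> < max d (\<bar>a\<bar> * d)"
    using \<open>d > 0\<close> by (intro less) (simp add: less_max_iff_disj)
  \<comment> \<open>If \<open>\<bar>a\<bar> \<ge> 1\<close>, the maximum would be
    \<open>\<bar>a\<bar> * d\<close> and the chain would read
    \<open>\<bar>a\<bar> * d < \<bar>a\<bar> * d\<close>.\<close>
  finally show ?thesis
    using \<open>d > 0\<close> by (simp add: less_max_iff_disj)
qed

lemma atLeastAtMost_eq_UN_consecutive:
  fixes ys :: "nat \<Rightarrow> 'a :: linorder"
  assumes "P \<ge> 1" and "mono_on {0..P} ys"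
  shows "{ys 0..ys P} = (\<Union>p\<in>{1..P}. {ys (p - 1)..ys p})"
  using assms
proof (induction P rule: nat_induct_at_least)
  case base
  then show ?case
    by simp
next
  case (Suc n)
  have "mono_on {0..n} ys"
    using Suc.prems by (rule mono_on_subset) simp
  then have "{ys 0..ys n} = (\<Union>p\<in>{1..n}. {ys (p - 1)..ys p})"
    by (rule Suc.IH)
  moreover have "{ys 0..ys (Suc n)} = {ys 0..ys n} \<union> {ys n..ys (Suc n)}"
    using mono_onD [OF Suc.prems, of 0 n] mono_onD [OF Suc.prems, of n "Suc n"]
    by (simp add: ivl_disj_un_two_touch(4))
  ultimately show ?case
    by (simp add: atLeastAtMostSuc_conv Un_commute)
qed

text \<open>On a compact set a continuous function is bounded, so the boundedness built into
  \<open>cfunspace\<close> is automatic.\<close>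

lemma C_space_iff:
  fixes h :: "real \<Rightarrow> real"
  assumes "compact A"
  shows "h \<in> C_space A \<longleftrightarrow> h \<in> extensional A \<and> continuous_on A h"
  using assms compact_imp_bounded [OF compact_continuous_image, of A h] by auto

lemma C0_space_iff:
  "h \<in> C0_space P ys zs \<longleftrightarrow>
     h \<in> extensional {ys 0..ys P} \<and> continuous_on {ys 0..ys P} h \<and> h (ys 0) = zs 0 \<and> h (ys P) = zs P"
  unfolding C0_space_def mem_Collect_eq C_space_iff [OF compact_Icc] by blast

text \<open>The Banach fixed point theorem needs a starting point; the affine interpolant of the two
  end data provides one.\<close>

lemma C0_space_nonempty:
  assumes "ys 0 < ys P"
  shows "C0_space P ys zs \<noteq> {}"
proof -
  define h where "h = (\<lambda>y. zs 0 + (zs P - zs 0) / (ys P - ys 0) * (y - ys 0))"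
  have "continuous_on {ys 0..ys P} h"
    unfolding h_def by (intro continuous_intros)
  then have "continuous_on {ys 0..ys P} (restrict h {ys 0..ys P})"
    by (rule continuous_on_eq) simp
  then have "restrict h {ys 0..ys P} \<in> C0_space P ys zs"
    using assms unfolding C0_space_iff by (simp add: h_def del: restrict_apply) simp
  then show ?thesis
    by blast
qed

lemma Submetric_C0_space:
  "Submetric (C_space {ys 0..ys P}) (mdist (C_metric {ys 0..ys P})) (C0_space P ys zs)"
  unfolding Submetric_def Submetric_axioms_def
  by (auto simp only: C0_space_def Metric_space_mspace_mdist)

text \<open>Uniform limits preserve the values at the two end points, so this is a closed subspace
  of the complete space of continuous functions.\<close>

lemma mcomplete_C0_space:
  assumes "ys 0 \<le> ys P"
  shows "Metric_space.mcomplete (C0_space P ys zs) (mdist (C_metric {ys 0..ys P}))"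
proof -
  interpret Submetric "C_space {ys 0..ys P}" "mdist (C_metric {ys 0..ys P})" "C0_space P ys zs"
    by (rule Submetric_C0_space)
  show ?thesis
  proof (rule sequentially_closedin_mcomplete_imp_mcomplete)
    \<comment> \<open>The completeness theorem for \<open>cfunspace\<close> speaks of the locale's
      own metric, which is identified here with the one in \<open>C_metric\<close>.\<close>
    have "Met_TC.Self = (euclidean_metric :: real metric)"
      by (simp add: Met_TC.Self_def euclidean_metric_def)
    moreover have "mcomplete_of (cfunspace (top_of_set {ys 0..ys P}) (Met_TC.Self :: real metric))"
      by (rule Met_TC.mcomplete_cfunspace) (simp add: complete_UNIV)
    ultimately show "mcomplete"
      by (simp only: mcomplete_of_def)
  next
    fix \<sigma> l
    assume \<sigma>: "range \<sigma> \<subseteq> C0_space P ys zs \<and> limitin mtopology \<sigma> l sequentially"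
    then have l: "l \<in> C_space {ys 0..ys P}"
      by (blast dest: limitin_mspace)
    \<comment> \<open>Otherwise \<open>dist c (l x)\<close> is a positive radius. Some
      \<open>\<sigma> n\<close> lies closer to \<open>l\<close> than that in the sup metric,
      although its value at \<open>x\<close> is \<open>c\<close>.\<close>
    have "l x = c" if x: "x \<in> {ys 0..ys P}" and c: "\<And>n. \<sigma> n x = c" for x c
    proof (rule ccontr)
      assume "l x \<noteq> c"
      then obtain n where n: "\<sigma> n \<in> C_space {ys 0..ys P}"
          "mdist (C_metric {ys 0..ys P}) (\<sigma> n) l < dist c (l x)"
        using \<sigma> unfolding limit_metric_sequentially by (metis order_refl zero_less_dist_iff)
      then have "dist (\<sigma> n x) (l x) \<le> mdist (C_metric {ys 0..ys P}) (\<sigma> n) l"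
        using mdist_cfunspace_imp_mdist_le [OF n(1) l order_refl, of x] x by simp
      with n(2) c show False
        by simp
    qed
    from this [of "ys 0" "zs 0"] this [of "ys P" "zs P"] show "l \<in> C0_space P ys zs"
      using \<sigma> l assms by (auto simp only: C0_space_def image_subset_iff mem_Collect_eq
          atLeastAtMost_iff order_refl UNIV_I)
  qed
qed

theorem theorem6:
  fixes P :: nat
    and ys zs \<alpha> :: "nat \<Rightarrow> real"
    and L q :: "nat \<Rightarrow> real \<Rightarrow> real"
    and F :: "nat \<Rightarrow> real \<Rightarrow> real \<Rightarrow> real"
    and A :: "real set"
  defines "A \<equiv> {ys 0..ys P}"
  assumes "P \<ge> 1"
    and "strict_mono_on {0..P} ys"
    and "\<And>p. p \<in> {1..P} \<Longrightarrow>
           homeomorphism A {ys (p - 1)..ys p} (L p) (inv_into A (L p))"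
    and "\<And>p. p \<in> {1..P} \<Longrightarrow> \<exists>c<1. c-lipschitz_on A (L p)"
    and "\<And>p. p \<in> {1..P} \<Longrightarrow> L p (ys 0) = ys (p - 1) \<and> L p (ys P) = ys p"
    and "\<And>p y z. p \<in> {1..P} \<Longrightarrow> y \<in> A \<Longrightarrow> F p y z = \<alpha> p * z + q p y"
    and "\<And>p. p \<in> {1..P} \<Longrightarrow> continuous_on A (q p)"
    and "\<And>p z. p \<in> {1..P} \<Longrightarrow> continuous_on A (\<lambda>y. F p y z)"
    and "STGPC P A F"
    and "\<And>p. p \<in> {1..P} \<Longrightarrow> F p (ys 0) (zs 0) = zs (p - 1) \<and> F p (ys P) (zs P) = zs p"
  shows "RB_operator P ys L F \<in> C0_space P ys zs \<rightarrow> C0_space P ys zs \<and>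
         (\<forall>h\<in>C0_space P ys zs. \<forall>p\<in>{1..P}. \<forall>y\<in>{ys (p - 1)..ys p}.
            RB_operator P ys L F h y
              = F p (inv_into A (L p) y) (h (inv_into A (L p) y))) \<and>
         (\<exists>g\<in>C0_space P ys zs. RB_operator P ys L F g = g)"
proof -
  note mono = assms(3) and homeo = assms(4) and ends = assms(6) and aff = assms(7)
    and q_cont = assms(8) and match = assms(11)
  let ?T = "RB_operator P ys L F" and ?C0 = "C0_space P ys zs"
  let ?inv = "\<lambda>p. inv_into A (L p)"

  have ys_less: "ys i < ys j" if "i < j" "j \<le> P" for i j
    using mono that by (intro strict_mono_onD [OF mono]) auto
  have ys_0P: "ys 0 < ys P"
    using ys_less [of 0 P] \<open>P \<ge> 1\<close> by simp
  have endpoints_in_A: "ys 0 \<in> A" "ys P \<in> A"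
    using ys_0P by (simp_all add: A_def)
  have cover: "A = (\<Union>p\<in>{1..P}. {ys (p - 1)..ys p})"
    unfolding A_def using \<open>P \<ge> 1\<close> mono
    by (intro atLeastAtMost_eq_UN_consecutive strict_mono_on_imp_mono_on)

  have inv_in_A: "?inv p y \<in> A" if "p \<in> {1..P}" "y \<in> {ys (p - 1)..ys p}" for p y
    using homeo [OF that(1)] that(2) by (auto simp: homeomorphism_def)
  have inv_L: "?inv p (L p x) = x" if "p \<in> {1..P}" "x \<in> A" for p x
    using homeo [OF that(1)] that(2) by (auto simp: homeomorphism_def)
  have inv_left: "?inv p (ys (p - 1)) = ys 0" and inv_right: "?inv p (ys p) = ys P"
    if "p \<in> {1..P}" for p
    using inv_L [OF that] ends [OF that] endpoints_in_A by metis+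

  \<comment> \<open>The \<open>LEAST\<close> in the operator selects one branch; any other piece
    containing \<open>y\<close> must give the same value. This makes the operator well defined at
    the nodes.\<close>
  have T_eq: "?T h y = F p (?inv p y) (h (?inv p y))"
    if h: "h \<in> ?C0" and p: "p \<in> {1..P}" and y: "y \<in> {ys (p - 1)..ys p}" for h p y
  proof -
    define r where "r = (LEAST p. p \<in> {1..P} \<and> y \<in> {ys (p - 1)..ys p})"
    have r: "r \<in> {1..P}" "y \<in> {ys (r - 1)..ys r}"
      using LeastI [of "\<lambda>p. p \<in> {1..P} \<and> y \<in> {ys (p - 1)..ys p}" p] p y
      unfolding r_def by blast+
    have "r \<le> p"
      unfolding r_def using p y by (blast intro: Least_le)
    have "y \<in> A"
      using p y cover by blast
    then have T_r: "?T h y = F r (?inv r y) (h (?inv r y))"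
      by (simp add: RB_operator_def Let_def A_def r_def)
    show ?thesis
    proof (cases "r = p")
      case True
      with T_r show ?thesis
        by simp
    next
      case False
      \<comment> \<open>Otherwise \<open>y \<le> ys r < ys (p - 1) \<le> y\<close>. Hence two
        distinct pieces containing \<open>y\<close> are neighbours.\<close>
      have "\<not> r < p - 1"
        using ys_less [of r "p - 1"] r(2) y p by fastforce
      with False \<open>r \<le> p\<close> have r_eq: "r = p - 1"
        by simp
      \<comment> \<open>At this node branch \<open>r\<close> is evaluated at the right end of
        \<open>A\<close> and branch \<open>p\<close> at the left end; by the matching conditions
        both give \<open>zs (p - 1)\<close>.\<close>
      with r(2) y have "y = ys (p - 1)"
        by simp
      moreover have "h (ys 0) = zs 0" "h (ys P) = zs P"
        using h by (simp_all only: C0_space_iff)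
      ultimately show ?thesis
        using T_r inv_right [OF r(1)] inv_left [OF p] match [OF r(1)] match [OF p] r_eq by simp
    qed
  qed

  have T_C0: "?T h \<in> ?C0" if h: "h \<in> ?C0" for h
  proof -
    have h_cont: "continuous_on A h"
      using h by (simp only: C0_space_iff A_def)
    have "continuous_on {ys (p - 1)..ys p} (?T h)" if p: "p \<in> {1..P}" for p
    proof -
      have inv_cont: "continuous_on {ys (p - 1)..ys p} (?inv p)"
        and inv_image: "?inv p ` {ys (p - 1)..ys p} \<subseteq> A"
        using homeo [OF p] by (auto simp: homeomorphism_def)
      \<comment> \<open>The affine form reduces continuity of the branch to that of
        \<open>h\<close>, \<open>q p\<close> and the inverse of \<open>L p\<close>.\<close>
      have "continuous_on {ys (p - 1)..ys p} (\<lambda>y. \<alpha> p * h (?inv p y) + q p (?inv p y))"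
        by (intro continuous_intros continuous_on_compose2 [OF h_cont inv_cont inv_image]
            continuous_on_compose2 [OF q_cont [OF p] inv_cont inv_image])
      then show ?thesis
        by (rule continuous_on_eq) (simp add: T_eq [OF h p] aff [OF p] inv_in_A [OF p])
    qed
    \<comment> \<open>Pasting: the pieces are closed and finite in number.\<close>
    then have "continuous_on A (?T h)"
      unfolding cover by (intro continuous_on_closed_Union) auto
    moreover have "?T h (ys 0) = zs 0"
      using T_eq [OF h, of 1 "ys 0"] inv_left [of 1] match [of 1] ys_less [of 0 1] h \<open>P \<ge> 1\<close>
      by (simp add: C0_space_iff)
    moreover have "?T h (ys P) = zs P"
      using T_eq [OF h, of P "ys P"] inv_right [of P] match [of P] ys_less [of "P - 1" P] h \<open>P \<ge> 1\<close>
      by (simp add: C0_space_iff)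
    ultimately show ?thesis
      by (simp add: C0_space_iff A_def RB_operator_def)
  qed

  have slope: "\<bar>\<alpha> p\<bar> < 1" if p: "p \<in> {1..P}" for p
  proof -
    \<comment> \<open>The slope \<open>\<alpha> p\<close> does not depend on the point of
      \<open>A\<close>, so the condition at \<open>ys 0\<close> alone bounds it.\<close>
    obtain \<phi> where "comparison_function \<phi>"
      and Suzuki: "\<And>z t. 1/2 * \<bar>z - F p (ys 0) z\<bar> \<le> \<bar>z - t\<bar> \<Longrightarrow>
          \<bar>F p (ys 0) z - F p (ys 0) t\<bar>
            \<le> \<phi> (Max {\<bar>z - t\<bar>, \<bar>z - F p (ys 0) z\<bar>, \<bar>t - F p (ys 0) t\<bar>})"
      using \<open>STGPC P A F\<close> p endpoints_in_A(1) unfolding STGPC_def by blast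
    then have "\<And>t. t > 0 \<Longrightarrow> \<phi> t < t"
      by (simp add: comparison_function_def)
    then show ?thesis
      by (rule Suzuki_affine_slope_less_one [OF _ aff [OF p endpoints_in_A(1)] Suzuki])
  qed
  \<comment> \<open>A maximum over a finite nonempty index set stays strictly below 1, giving one
    factor for all branches.\<close>
  define c where "c = Max ((\<lambda>p. \<bar>\<alpha> p\<bar>) ` {1..P})"
  have "c < 1"
    using slope \<open>P \<ge> 1\<close> by (simp add: c_def)
  have slope_le: "\<bar>\<alpha> p\<bar> \<le> c" if "p \<in> {1..P}" for p
    using that by (simp add: c_def)

  interpret Submetric "C_space A" "mdist (C_metric A)" ?C0
    unfolding A_def by (rule Submetric_C0_space)

  have contraction: "mdist (C_metric A) (?T g) (?T h) \<le> c * mdist (C_metric A) g h"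
    if g: "g \<in> ?C0" and h: "h \<in> ?C0" for g h
  proof -
    have "dist (?T g y) (?T h y) \<le> c * mdist (C_metric A) g h" if y: "y \<in> A" for y
    proof -
      obtain p where p: "p \<in> {1..P}" "y \<in> {ys (p - 1)..ys p}"
        using y cover by blast
      let ?x = "?inv p y"
      \<comment> \<open>Both images use the same branch at \<open>y\<close>, so the
        \<open>q p\<close> terms cancel.\<close>
      have "?T g y - ?T h y = \<alpha> p * (g ?x - h ?x)"
        using p by (simp add: T_eq g h aff inv_in_A algebra_simps)
      then have "dist (?T g y) (?T h y) = \<bar>\<alpha> p\<bar> * dist (g ?x) (h ?x)"
        by (simp add: dist_real_def abs_mult)
      also have "\<dots> \<le> c * mdist (C_metric A) g h"
      proof (intro mult_mono)
        show "dist (g ?x) (h ?x) \<le> mdist (C_metric A) g h"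
          using mdist_cfunspace_imp_mdist_le [OF _ _ order_refl, of g _ _ h ?x] g h subset
            inv_in_A [OF p] by (metis mdist_euclidean_metric subsetD topspace_euclidean_subtopology)
        show "0 \<le> c"
          using slope_le [OF p(1)] by linarith
      qed (use slope_le [OF p(1)] in auto)
      finally show ?thesis .
    qed
    moreover have "?T g \<in> C_space A" "?T h \<in> C_space A"
      using T_C0 g h subset by blast+
    ultimately show ?thesis
      \<comment> \<open>Passing from the pointwise bound to the sup metric requires \<open>A\<close>
        to be nonempty.\<close>
      using endpoints_in_A(1) by (subst cfunspace_mdist_le) auto
  qed

  have "sub.mcomplete"
    unfolding A_def using ys_0P by (intro mcomplete_C0_space) simp
  moreover have "?C0 \<noteq> {}"
    using ys_0P by (rule C0_space_nonempty)
  moreover have "?T \<in> ?C0 \<rightarrow> ?C0"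
    using T_C0 by blast
  ultimately obtain g where "g \<in> ?C0" "?T g = g"
    using sub.Banach_fixedpoint_thm [of ?T c] \<open>c < 1\<close> contraction by blast
  then show ?thesis
    using T_C0 T_eq by blast
qed

end
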